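(* Let $\widehat p_{M+1}=Z_{M+1}/r_M$ be the multilevel splitting estimator of $p$. Its coefficient of variation is given by $$\frac{\mathrm{Var}(\widehat p_{M+1})}{p^2}=\sum_{k=1}^M \frac{1}{\gamma_k(\mathbf 1)}\left(\frac1{r_{k-1}}-\frac1{r_k}\right)\frac{\mathrm{Var}_{\mu_k}(f_k)}{\mathbb E_{\mu_k}^2(f_k)}+\sum_{k=0}^M\frac{1}{r_k\gamma_k(\mathbf 1)}\,\frac{1-\mu_k(g_k)}{\mu_k(g_k)} .$$ Moreover, with the operators $\Gamma_{i+1}$ defined by $\Gamma_{i+1}(f,g)=P_{i+1}(fg)-P_{i+1}(f)P_{i+1}(g)$ for functions $f,g\in\mathcal F_{i+1}$, and $\Gamma_{i+1}(f):=\Gamma_{i+1}(f,f)$, one has $$\mathrm{Var}(\widehat p_{M+1})=\sum_{i=0}^M\frac1{r_i}\,\gamma_i\bigl(\Gamma_{i+1}(f_{i+1})\bigr).$$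
   Context: **Model.** Fix integers $M\ge1$ and $s\ge 1$. There are nested events (thresholds) $B=B_{M+1}\subset B_M\subset\dots\subset B_1$. For $1\le k\le M$ the frontier $\partial B_k$ is partitioned into $s$ disjoint subsets $\partial B_k^{(1)},\dots,\partial B_k^{(s)}$. A particle starts at a fixed point $O$ and evolves so that a threshold can be hit only if all previous ones have been hit. Let $\tau_k$ be the first hitting time of $\partial B_k$ (with $\tau_0<\infty$ surely), and let $X_k=i$ if the particle is in $\partial B_k^{(i)}$ at time $\tau_k$. The embedded process $(X_k)$, killed at level $k$ if $\tau_k=\infty$, is a Markov chain. Functions on $\partial B_k$ (the set $\mathcal F_k$) are functions on $\{1,\dots,s\}$. Measures on $\partial B_k$ are measures on $\{1,\dots,s\}$, and $\mu(f)=\sum_i\mu(i)f(i)$. **Quantities.** The target is $p=\mathbb P(\tau_{M+1}<\infty)$. For $1\le k\le M$: - $\gamma_k(i)=\mathbb P(X_k=i,\ \tau_k<\infty)$, so $\gamma_k(\mathbf 1)=\mathbb P(\tau_k<\infty)$, where $\mathbf 1$ is the unit function; - $f_k(i)=\mathbb P(\tau_{M+1}<\infty\mid X_k=i,\ \tau_k<\infty)$; - $\mu_k=\gamma_k/\gamma_k(\mathbf 1)$, a probability measure. For $2\le k\le M$: $P_k(i,j)=\mathbb P(X_k=j,\ \tau_k<\infty\mid X_{k-1}=i,\ \tau_{k-1}<\infty)$, acting on functions by $P_k(f)(i)=\sum_jP_k(i,j)f(j)$, and $g_{k-1}(i)=P_k(\mathbf 1)(i)$. It is assumed that $\gamma_k(\mathbf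 1)\ne0$ for all $k$ (including $\gamma_{M+1}(\mathbf 1)=p\neq0$). For a probability measure $\mu$, $\mathbb E_\mu(f)=\mu(f)$ and $\mathrm{Var}_\mu(f)=\mu(f^2)-\mu(f)^2$. **Conventions at the ends.** $\mathcal F_0$ and $\mathcal F_{M+1}$ consist of constants. At level $0$: $f_0=p$, $g_0=\gamma_1(\mathbf 1)$, $\gamma_0(f)=\mu_0(f)=f$, $\gamma_0(\mathbf 1)=1$, $P_1(f)=\gamma_1(f)$. At the last levels: $f_{M+1}=1$, $g_M=f_M$, $\gamma_{M+1}(f)=pf$, $\mu_{M+1}(f)=f$, and $P_{M+1}(f)=f\times f_M$ (the constant $f$ times the function $f_M$). **Algorithm.** Let $N\ge1$ and $R_1,\dots,R_M\ge1$ be integers, $r_0=N$, $r_n=R_nr_{n-1}$. First, $N$ independent particles start from $O$. Each independently lands in $\partial B_1^{(j)}$ with probability $\gamma_1(j)$ and dies with probability $1-\gamma_1(\mathbf 1)$; $Z_{1j}$ is the number landing in $\partial B_1^{(j)}$. For $2\le n\le M$, given $\mathbf Z_{n-1}=(Z_{(n-1)1},\dots,Z_{(n-1)s})$, each particle is duplicated $R_{n-1}$ times, and each of the $R_{n-1}Z_{(n-1)i}$ copies located in $\partial B_{n-1}^{(i)}$ independently reaches $\partial B_n^{(j)}$ with probability $P_n(i,j)$ ($j=1,\dots,s$) and dies with probability $1-g_{n-1}(i)$; $Z_{nj}$ is the number of copies reaching $\partial B_n^{(j)}$. Finally, given $\mathbf Z_M$, each particle is duplicated $R_M$ times, and each of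 the $R_MZ_{Mi}$ copies located in $\partial B_M^{(i)}$ independently reaches $B_{M+1}$ with probability $f_M(i)$; $Z_{M+1}$ is the total number of copies reaching $B_{M+1}$. The estimator is $\widehat p_{M+1}=Z_{M+1}/r_M=Z_{M+1}/(NR_1\cdots R_M)$. *)

theory Defs
  imports "HOL-Probability.Probability"
begin

section \<open>The particle and its thresholds\<close>

text \<open>
  The frontiers are arbitrary sets of states: topological frontiers are a special case, and no
  topology on the state space is needed. Level \<open>0\<close> is the starting point \<open>O\<close>. A particle that dies
  is one whose trajectory never meets the remaining frontiers.
\<close>

record ('w, 'x) splitting_model =
  law :: "'w measure"
  traj :: "real \<Rightarrow> 'w \<Rightarrow> 'x"
  origin :: 'x
  levels :: nat
  cells :: nat
  threshold :: "nat \<Rightarrow> 'x set"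
  front :: "nat \<Rightarrow> 'x set"
  piece :: "nat \<Rightarrow> nat \<Rightarrow> 'x set"

definition hit_time :: "('w, 'x) splitting_model \<Rightarrow> nat \<Rightarrow> 'w \<Rightarrow> ereal" where
  "hit_time S k \<omega> = Inf (ereal ` {t. 0 \<le> t \<and> traj S t \<omega> \<in> front S k})"

text \<open>
  Only the frontiers \<open>1, \<dots>, M\<close> are split into \<open>s\<close> pieces; levels \<open>0\<close> and \<open>M + 1\<close> carry a single
  piece, with index \<open>1\<close>. A function on \<open>\<partial>B\<^sub>k\<close> is a function \<open>nat \<Rightarrow> real\<close> of which only the
  values on \<open>idx S k\<close> matter; at levels \<open>0\<close> and \<open>M + 1\<close> it is thus a constant.
\<close>

definition idx :: "('w, 'x) splitting_model \<Rightarrow> nat \<Rightarrow> nat set" where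
  "idx S k = (if 1 \<le> k \<and> k \<le> levels S then {1..cells S} else {1})"

definition cell :: "('w, 'x) splitting_model \<Rightarrow> nat \<Rightarrow> nat \<Rightarrow> 'x set" where
  "cell S k i = (if 1 \<le> k \<and> k \<le> levels S then piece S k i else front S k)"

definition pos :: "('w, 'x) splitting_model \<Rightarrow> nat \<Rightarrow> 'w \<Rightarrow> nat" where
  "pos S k \<omega> = (THE i. i \<in> idx S k \<and> traj S (real_of_ereal (hit_time S k \<omega>)) \<omega> \<in> cell S k i)"

text \<open>The embedded process, with \<^term>\<open>None\<close> as the killed state.\<close>

definition killed_pos :: "('w, 'x) splitting_model \<Rightarrow> nat \<Rightarrow> 'w \<Rightarrow> nat option" where
  "killed_pos S k \<omega> = (if hit_time S k \<omega> < \<infinity> then Some (pos S k \<omega>) else None)"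


section \<open>Quantities attached to the levels\<close>

definition hit_prob :: "('w, 'x) splitting_model \<Rightarrow> real" where
  "hit_prob S = \<P>(\<omega> in law S. hit_time S (levels S + 1) \<omega> < \<infinity>)"

definition gam :: "('w, 'x) splitting_model \<Rightarrow> nat \<Rightarrow> nat \<Rightarrow> real" where
  "gam S k i =
     (if k = 0 then 1
      else if k = levels S + 1 then hit_prob S
      else \<P>(\<omega> in law S. pos S k \<omega> = i \<and> hit_time S k \<omega> < \<infinity>))"

definition gam_op :: "('w, 'x) splitting_model \<Rightarrow> nat \<Rightarrow> (nat \<Rightarrow> real) \<Rightarrow> real" where
  "gam_op S k \<phi> = (\<Sum>i\<in>idx S k. gam S k i * \<phi> i)"

abbreviation gam1 :: "('w, 'x) splitting_model \<Rightarrow> nat \<Rightarrow> real" where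
  "gam1 S k \<equiv> gam_op S k (\<lambda>_. 1)"

definition mu :: "('w, 'x) splitting_model \<Rightarrow> nat \<Rightarrow> nat \<Rightarrow> real" where
  "mu S k i = gam S k i / gam1 S k"

definition mu_op :: "('w, 'x) splitting_model \<Rightarrow> nat \<Rightarrow> (nat \<Rightarrow> real) \<Rightarrow> real" where
  "mu_op S k \<phi> = (\<Sum>i\<in>idx S k. mu S k i * \<phi> i)"

definition mu_var :: "('w, 'x) splitting_model \<Rightarrow> nat \<Rightarrow> (nat \<Rightarrow> real) \<Rightarrow> real" where
  "mu_var S k \<phi> = mu_op S k (\<lambda>i. (\<phi> i)\<^sup>2) - (mu_op S k \<phi>)\<^sup>2"

text \<open>
  Conditional probabilities given a null event are \<open>0\<close>. The states \<open>i\<close> concerned satisfy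
  \<^term>\<open>gam S k i = 0\<close> and are almost surely never visited.
\<close>

definition f_val :: "('w, 'x) splitting_model \<Rightarrow> nat \<Rightarrow> nat \<Rightarrow> real" where
  "f_val S k i =
     (if k = 0 then hit_prob S
      else if k = levels S + 1 then 1
      else \<P>(\<omega> in law S. hit_time S (levels S + 1) \<omega> < \<infinity> \<bar> pos S k \<omega> = i \<and> hit_time S k \<omega> < \<infinity>))"

text \<open>
  Kernel from level \<open>k - 1\<close> to level \<open>k\<close>, for \<open>1 \<le> k \<le> M + 1\<close>. The first two cases encode the
  conventions \<open>P\<^sub>1(\<phi>) = \<gamma>\<^sub>1(\<phi>)\<close> and \<open>P\<^sub>M\<^sub>+\<^sub>1(\<phi>) = \<phi> \<times> f\<^sub>M\<close>.
\<close>

definition kern :: "('w, 'x) splitting_model \<Rightarrow> nat \<Rightarrow> nat \<Rightarrow> nat \<Rightarrow> real" where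
  "kern S k i j =
     (if k = 1 then gam S 1 j
      else if k = levels S + 1 then f_val S (levels S) i
      else \<P>(\<omega> in law S. pos S k \<omega> = j \<and> hit_time S k \<omega> < \<infinity>
                       \<bar> pos S (k - 1) \<omega> = i \<and> hit_time S (k - 1) \<omega> < \<infinity>))"

definition P_op :: "('w, 'x) splitting_model \<Rightarrow> nat \<Rightarrow> (nat \<Rightarrow> real) \<Rightarrow> nat \<Rightarrow> real" where
  "P_op S k \<phi> i = (\<Sum>j\<in>idx S k. kern S k i j * \<phi> j)"

text \<open>In particular \<open>g\<^sub>0 = \<gamma>\<^sub>1(1)\<close> and \<open>g\<^sub>M = f\<^sub>M\<close>.\<close>

definition g_val :: "('w, 'x) splitting_model \<Rightarrow> nat \<Rightarrow> nat \<Rightarrow> real" where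
  "g_val S k = P_op S (k + 1) (\<lambda>_. 1)"

definition Gam_op ::
  "('w, 'x) splitting_model \<Rightarrow> nat \<Rightarrow> (nat \<Rightarrow> real) \<Rightarrow> (nat \<Rightarrow> real) \<Rightarrow> nat \<Rightarrow> real" where
  "Gam_op S k \<phi> \<psi> i = P_op S k (\<lambda>j. \<phi> j * \<psi> j) i - P_op S k \<phi> i * P_op S k \<psi> i"

abbreviation Gam_diag :: "('w, 'x) splitting_model \<Rightarrow> nat \<Rightarrow> (nat \<Rightarrow> real) \<Rightarrow> nat \<Rightarrow> real" where
  "Gam_diag S k \<phi> \<equiv> Gam_op S k \<phi> \<phi>"


section \<open>Standing assumptions\<close>

locale multilevel_splitting = prob_space "law S" for S :: "('w, 'x) splitting_model" +
  assumes levels_pos: "1 \<le> levels S"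
    and cells_pos: "1 \<le> cells S"
    and nested: "\<And>k. 1 \<le> k \<Longrightarrow> k \<le> levels S \<Longrightarrow> threshold S (k + 1) \<subseteq> threshold S k"
    and partition_Un: "\<And>k. 1 \<le> k \<Longrightarrow> k \<le> levels S \<Longrightarrow> (\<Union>i\<in>{1..cells S}. piece S k i) = front S k"
    and partition_disjoint:
      "\<And>k. 1 \<le> k \<Longrightarrow> k \<le> levels S \<Longrightarrow> disjoint_family_on (piece S k) {1..cells S}"
    and start: "\<And>\<omega>. \<omega> \<in> space (law S) \<Longrightarrow> traj S 0 \<omega> = origin S"
    and front_0: "front S 0 = {origin S}"
    and hit_attained: "\<And>k \<omega>. \<omega> \<in> space (law S) \<Longrightarrow> k \<le> levels S + 1 \<Longrightarrow> hit_time S k \<omega> < \<infinity> \<Longrightarrow>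
      traj S (real_of_ereal (hit_time S k \<omega>)) \<omega> \<in> front S k"
    and hit_previous: "\<And>j k \<omega>. \<omega> \<in> space (law S) \<Longrightarrow> j \<le> k \<Longrightarrow> k \<le> levels S + 1 \<Longrightarrow>
      hit_time S j \<omega> \<le> hit_time S k \<omega>"
    and killed_pos_measurable:
      "\<And>k. k \<le> levels S + 1 \<Longrightarrow> killed_pos S k \<in> measurable (law S) (count_space UNIV)"
    and markov: "\<And>k h j. k \<le> levels S \<Longrightarrow>
      \<P>(\<omega> in law S. \<forall>m\<le>k. killed_pos S m \<omega> = h m) > 0 \<Longrightarrow>
      \<P>(\<omega> in law S. killed_pos S (k + 1) \<omega> = j \<bar> \<forall>m\<le>k. killed_pos S m \<omega> = h m)
        = \<P>(\<omega> in law S. killed_pos S (k + 1) \<omega> = j \<bar> killed_pos S k \<omega> = h k)"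
    and gam1_nonzero: "\<And>k. 1 \<le> k \<Longrightarrow> k \<le> levels S + 1 \<Longrightarrow> gam1 S k \<noteq> 0"


section \<open>The splitting algorithm\<close>

primrec rep :: "nat \<Rightarrow> (nat \<Rightarrow> nat) \<Rightarrow> nat \<Rightarrow> nat" where
  "rep N R 0 = N"
| "rep N R (Suc n) = R (Suc n) * rep N R n"

text \<open>
  Law of the fate at level \<open>n\<close> of one copy located in the piece \<open>i\<close> of level \<open>n - 1\<close>;
  \<^term>\<open>None\<close> means death.
\<close>

definition fate :: "('w, 'x) splitting_model \<Rightarrow> nat \<Rightarrow> nat \<Rightarrow> nat option pmf" where
  "fate S n i = embed_pmf (\<lambda>x. case x of
       Some j \<Rightarrow> (if j \<in> idx S n then kern S n i j else 0)
     | None \<Rightarrow> 1 - g_val S (n - 1) i)"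

text \<open>
  Given \<open>m i\<close> particles in each piece \<open>i \<in> I\<close>, all moving independently, the law of the numbers of
  particles arriving in each piece of the next level.
\<close>

definition move :: "nat set \<Rightarrow> (nat \<Rightarrow> nat option pmf) \<Rightarrow> (nat \<Rightarrow> nat) \<Rightarrow> (nat \<Rightarrow> nat) pmf" where
  "move I F m =
     map_pmf (\<lambda>\<xi> j. card {c \<in> (SIGMA i:I. {..<m i}). \<xi> c = Some j})
       (Pi_pmf (SIGMA i:I. {..<m i}) None (\<lambda>(i, l). F i))"

text \<open>
  Law of the counts \<open>Z\<^sub>n\<close>. There are \<open>N\<close> particles at level \<open>0\<close>, which are not duplicated.
  The total \<open>Z\<^sub>M\<^sub>+\<^sub>1\<close> is the value at the single index \<open>1\<close> of level \<open>M + 1\<close>.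
\<close>

primrec Z_pmf ::
  "('w, 'x) splitting_model \<Rightarrow> nat \<Rightarrow> (nat \<Rightarrow> nat) \<Rightarrow> nat \<Rightarrow> (nat \<Rightarrow> nat) pmf" where
  "Z_pmf S N R 0 = return_pmf (\<lambda>i. if i = 1 then N else 0)"
| "Z_pmf S N R (Suc n) =
     bind_pmf (Z_pmf S N R n)
       (\<lambda>z. move (idx S n) (fate S (Suc n)) (\<lambda>i. if n = 0 then z i else R n * z i))"

definition p_hat :: "('w, 'x) splitting_model \<Rightarrow> nat \<Rightarrow> (nat \<Rightarrow> nat) \<Rightarrow> (nat \<Rightarrow> nat) \<Rightarrow> real" where
  "p_hat S N R z = real (z 1) / real (rep N R (levels S))"

definition p_hat_var :: "('w, 'x) splitting_model \<Rightarrow> nat \<Rightarrow> (nat \<Rightarrow> nat) \<Rightarrow> real" where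
  "p_hat_var S N R = measure_pmf.variance (Z_pmf S N R (levels S + 1)) (p_hat S N R)"


text \<open>The weights in \<^const>\<open>fate\<close> do form a probability mass function.\<close>

context multilevel_splitting
begin

lemma pos_sets:
  assumes "k \<le> levels S + 1"
  shows "{\<omega> \<in> space (law S). pos S k \<omega> = i \<and> hit_time S k \<omega> < \<infinity>} \<in> events"
proof -
  have "{\<omega> \<in> space (law S). pos S k \<omega> = i \<and> hit_time S k \<omega> < \<infinity>}
      = killed_pos S k -` {Some i} \<inter> space (law S)"
    by (auto simp: killed_pos_def split: if_splits)
  then show ?thesis
    using measurable_sets[OF killed_pos_measurable[OF assms], of "{Some i}"] by simp
qed

lemma sum_pos_le:
  assumes k: "k \<le> levels S + 1" and A: "A \<in> events" and J: "finite J"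
  shows "(\<Sum>j\<in>J. prob ({\<omega> \<in> space (law S). pos S k \<omega> = j \<and> hit_time S k \<omega> < \<infinity>} \<inter> A)) \<le> prob A"
proof -
  have "(\<Sum>j\<in>J. prob ({\<omega> \<in> space (law S). pos S k \<omega> = j \<and> hit_time S k \<omega> < \<infinity>} \<inter> A))
      = prob (\<Union>j\<in>J. {\<omega> \<in> space (law S). pos S k \<omega> = j \<and> hit_time S k \<omega> < \<infinity>} \<inter> A)"
    by (rule finite_measure_finite_Union[symmetric])
       (use J A pos_sets[OF k] in \<open>auto simp: disjoint_family_on_def\<close>)
  also have "\<dots> \<le> prob A"
    using A by (intro finite_measure_mono) auto
  finally show ?thesis .
qed

lemma kern_nonneg: "0 \<le> kern S n i j"
  by (auto simp: kern_def gam_def f_val_def hit_prob_def cond_prob_def)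

lemma g_val_le_1:
  assumes "1 \<le> n" "n \<le> levels S + 1"
  shows "g_val S (n - 1) i \<le> 1"
proof -
  have cp: "(\<Sum>j\<in>J. \<P>(\<omega> in law S. pos S n \<omega> = j \<and> hit_time S n \<omega> < \<infinity> \<bar> pos S (n - 1) \<omega> = i \<and> hit_time S (n - 1) \<omega> < \<infinity>)) \<le> 1"
    if "finite J" for J
  proof -
    define A where "A = {\<omega> \<in> space (law S). pos S (n - 1) \<omega> = i \<and> hit_time S (n - 1) \<omega> < \<infinity>}"
    have A: "A \<in> events" unfolding A_def by (rule pos_sets) (use assms in auto)
    have eq: "{\<omega> \<in> space (law S). (pos S n \<omega> = j \<and> hit_time S n \<omega> < \<infinity>) \<and> pos S (n - 1) \<omega> = i \<and> hit_time S (n - 1) \<omega> < \<infinity>}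
       = {\<omega> \<in> space (law S). pos S n \<omega> = j \<and> hit_time S n \<omega> < \<infinity>} \<inter> A" for j
      by (auto simp: A_def)
    show ?thesis
      unfolding cond_prob_def eq A_def[symmetric] sum_divide_distrib[symmetric]
      using sum_pos_le[OF assms(2) A that] measure_nonneg[of "law S" A]
      by (auto simp: divide_le_eq_1 less_le)
  qed
  have g1: "(\<Sum>j\<in>idx S 1. gam S 1 j) \<le> 1"
  proof -
    have "(\<Sum>j\<in>idx S 1. gam S 1 j)
       = (\<Sum>j\<in>idx S 1. prob ({\<omega> \<in> space (law S). pos S 1 \<omega> = j \<and> hit_time S 1 \<omega> < \<infinity>} \<inter> space (law S)))"
      using levels_pos by (intro sum.cong) (auto simp: gam_def intro!: arg_cong[where f = prob])
    also have "\<dots> \<le> prob (space (law S))"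
      by (rule sum_pos_le) (auto simp: idx_def)
    finally show ?thesis by (simp add: prob_space)
  qed
  have fM: "f_val S (levels S) i \<le> 1"
  proof -
    have "{\<omega> \<in> space (law S). pos S (levels S) \<omega> = i \<and> hit_time S (levels S) \<omega> < \<infinity>} \<in> events"
      by (rule pos_sets) simp
    then show ?thesis using levels_pos
      by (auto simp: f_val_def cond_prob_def divide_le_eq_1 zero_less_measure_iff less_le intro!: finite_measure_mono)
  qed
  show ?thesis
  proof (cases "n = 1")
    case True
    then show ?thesis using g1 by (simp add: g_val_def P_op_def kern_def)
  next
    case n1: False
    show ?thesis
    proof (cases "n = levels S + 1")
      case True
      then show ?thesis using n1 fM by (simp add: g_val_def P_op_def kern_def idx_def)
    next
      case False
      then show ?thesis using n1 assms cp[of "idx S n"]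
        by (simp add: g_val_def P_op_def kern_def idx_def)
    qed
  qed
qed

lemma pmf_fate:
  assumes "1 \<le> n" "n \<le> levels S + 1"
  shows "pmf (fate S n i) x = (case x of
       Some j \<Rightarrow> (if j \<in> idx S n then kern S n i j else 0)
     | None \<Rightarrow> 1 - g_val S (n - 1) i)" (is "_ = ?w x")
  unfolding fate_def
proof (rule pmf_embed_pmf)
  show nn: "0 \<le> ?w x" for x
    using kern_nonneg g_val_le_1[OF assms] by (auto split: option.split)
  have fin: "finite (idx S n)" by (simp add: idx_def)
  have "(\<integral>\<^sup>+x. ennreal (?w x) \<partial>count_space UNIV)
      = (\<integral>\<^sup>+x. ennreal (?w x) \<partial>count_space (insert None (Some ` idx S n)))"
    by (rule nn_integral_count_space_eq) (auto split: option.splits)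
  also have "\<dots> = (\<Sum>x\<in>insert None (Some ` idx S n). ennreal (?w x))"
    by (rule nn_integral_count_space_finite) (simp add: fin)
  also have "\<dots> = ennreal (\<Sum>x\<in>insert None (Some ` idx S n). ?w x)"
    by (rule sum_ennreal) (rule nn)
  also have "(\<Sum>x\<in>insert None (Some ` idx S n). ?w x) = 1"
    using fin assms by (simp add: sum.reindex g_val_def P_op_def)
  finally show "(\<integral>\<^sup>+x. ennreal (?w x) \<partial>count_space UNIV) = 1" by simp
qed

end

end

theory Submission
  imports Defs
begin

text \<open>
  Write \<open>Z\<^sub>n(\<phi>)\<close> for the sum over the particles at level \<open>n\<close> of the value of \<open>\<phi>\<close> at their position, and \<open>R'\<^sub>n\<close>
  for the number of copies made of each of them, so that \<open>R'\<^sub>0 = 1\<close>. Given \<open>Z\<^sub>n\<close>, the number \<open>Z\<^sub>n\<^sub>+\<^sub>1(\<phi>)\<close> is a sum of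
  independent contributions, one per copy; so it has conditional mean \<open>R'\<^sub>n Z\<^sub>n(P\<^sub>n\<^sub>+\<^sub>1 \<phi>)\<close> and conditional
  variance \<open>R'\<^sub>n Z\<^sub>n(\<Gamma>\<^sub>n\<^sub>+\<^sub>1 \<phi>)\<close> (\<open>move_fate_moments\<close>). Two equations for the embedded chain close this recursion:

  \<^item> the forward equation \<open>\<gamma>\<^sub>n P\<^sub>n\<^sub>+\<^sub>1 = \<gamma>\<^sub>n\<^sub>+\<^sub>1\<close> (\<open>gam_op_P_op\<close>), which yields \<open>E Z\<^sub>n(\<phi>) = r\<^sub>n\<^sub>-\<^sub>1 \<gamma>\<^sub>n(\<phi>)\<close> for \<open>n \<ge> 1\<close>;
  \<^item> the backward equation \<open>P\<^sub>n\<^sub>+\<^sub>1 f\<^sub>n\<^sub>+\<^sub>1 = f\<^sub>n\<close> (\<open>P_op_f_val\<close>), which makes the normalised \<open>Z\<^sub>n(f\<^sub>n)\<close> a martingale.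

  That martingale starts at the constant \<open>p\<close> and ends at the estimator. Its variance is therefore the sum of
  its mean conditional variances, \<open>\<gamma>\<^sub>i(\<Gamma>\<^sub>i\<^sub>+\<^sub>1 f\<^sub>i\<^sub>+\<^sub>1) / r\<^sub>i\<close> at step \<open>i\<close>; this is the second formula
  (\<open>p_hat_var_Gam\<close>). The same two equations give \<open>\<gamma>\<^sub>i(\<Gamma>\<^sub>i\<^sub>+\<^sub>1 f\<^sub>i\<^sub>+\<^sub>1) = \<gamma>\<^sub>i\<^sub>+\<^sub>1(f\<^sub>i\<^sub>+\<^sub>1\<^sup>2) - \<gamma>\<^sub>i(f\<^sub>i\<^sup>2)\<close>, and summation
  by parts turns the second formula into the first (\<open>p_hat_cv\<close>).

  The Markov property enters through the backward equation, and this is the delicate point: \<open>f\<^sub>n\<close> is defined by conditioning on the cell at level \<open>n\<close> alone, while the Markov property speaks of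
  the next step given a complete history. So the probability of success is first shown, by downward
  induction on the level, to be the same for all complete histories that end in a given cell.
\<close>


section \<open>Moments of sums over independent copies\<close>

lemma expectation_bind_pmf_finite:
  fixes h :: "'b \<Rightarrow> real"
  assumes "finite (set_pmf p)" "\<And>x. x \<in> set_pmf p \<Longrightarrow> finite (set_pmf (f x))"
  shows "measure_pmf.expectation (bind_pmf p f) h
    = measure_pmf.expectation p (\<lambda>x. measure_pmf.expectation (f x) h)"
  using assms by (simp add: pmf_expectation_bind integral_measure_pmf[OF assms(1)])

lemma finite_set_Pi_pmf:
  assumes "finite A" "\<And>c. c \<in> A \<Longrightarrow> finite (set_pmf (F c))"
  shows "finite (set_pmf (Pi_pmf A d F))"
proof -
  have "finite (PiE_dflt A d (set_pmf \<circ> F))"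
    using assms by (intro finite_PiE_dflt) auto
  then show ?thesis
    by (rule finite_subset[OF set_Pi_pmf_subset'[OF assms(1)]])
qed

text \<open>
  Means and variances of independent summands add up; the second moment is the form in which
  this can be averaged over a random number of summands later.
\<close>

lemma sum_Pi_pmf_moments:
  fixes h :: "'b \<Rightarrow> real"
  assumes "finite A" "\<And>c. c \<in> A \<Longrightarrow> finite (set_pmf (F c))"
  defines "m \<equiv> \<lambda>c. measure_pmf.expectation (F c) h"
    and "v \<equiv> \<lambda>c. measure_pmf.expectation (F c) (\<lambda>x. (h x)\<^sup>2) - (measure_pmf.expectation (F c) h)\<^sup>2"
  shows "measure_pmf.expectation (Pi_pmf A d F) (\<lambda>\<xi>. \<Sum>c\<in>A. h (\<xi> c)) = (\<Sum>c\<in>A. m c)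
    \<and> measure_pmf.expectation (Pi_pmf A d F) (\<lambda>\<xi>. (\<Sum>c\<in>A. h (\<xi> c))\<^sup>2) = (\<Sum>c\<in>A. m c)\<^sup>2 + (\<Sum>c\<in>A. v c)"
  using assms(1,2)
proof (induction A rule: finite_induct)
  case empty
  then show ?case by simp
next
  case (insert a A)
  let ?E = "measure_pmf.expectation (Pi_pmf A d F)"
  let ?S = "\<lambda>\<xi>. \<Sum>c\<in>A. h (\<xi> c)"
  have fin: "finite (set_pmf (Pi_pmf A d F))"
    using insert by (intro finite_set_Pi_pmf) auto
  have int: "integrable (measure_pmf (Pi_pmf A d F)) f" for f :: "_ \<Rightarrow> real"
    by (rule integrable_measure_pmf_finite[OF fin])
  have int': "integrable (measure_pmf (F a)) f" for f :: "_ \<Rightarrow> real"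
    by (rule integrable_measure_pmf_finite) (use insert in auto)
  have upd: "(\<Sum>c\<in>insert a A. h ((\<xi>(a := y)) c)) = h y + ?S \<xi>" for \<xi> y
  proof -
    have "(\<Sum>c\<in>A. h ((\<xi>(a := y)) c)) = ?S \<xi>"
      using insert.hyps by (intro sum.cong) auto
    then show ?thesis using insert.hyps by simp
  qed
  have split: "measure_pmf.expectation (Pi_pmf (insert a A) d F) G
      = measure_pmf.expectation (F a) (\<lambda>y. ?E (\<lambda>\<xi>. G (\<xi>(a := y))))" for G :: "_ \<Rightarrow> real"
    using insert.hyps insert.prems fin
    by (simp add: Pi_pmf_insert' expectation_bind_pmf_finite)
  have IH: "?E ?S = (\<Sum>c\<in>A. m c)" "?E (\<lambda>\<xi>. (?S \<xi>)\<^sup>2) = (\<Sum>c\<in>A. m c)\<^sup>2 + (\<Sum>c\<in>A. v c)"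
    using insert.IH insert.prems by auto
  have "measure_pmf.expectation (Pi_pmf (insert a A) d F) (\<lambda>\<xi>. \<Sum>c\<in>insert a A. h (\<xi> c))
      = measure_pmf.expectation (F a) (\<lambda>y. h y + ?E ?S)"
    unfolding split upd using int by simp
  also have "\<dots> = (\<Sum>c\<in>insert a A. m c)"
    using int' insert.hyps by (simp add: IH m_def)
  finally have 1: "measure_pmf.expectation (Pi_pmf (insert a A) d F) (\<lambda>\<xi>. \<Sum>c\<in>insert a A. h (\<xi> c))
      = (\<Sum>c\<in>insert a A. m c)" .
  have "measure_pmf.expectation (Pi_pmf (insert a A) d F) (\<lambda>\<xi>. (\<Sum>c\<in>insert a A. h (\<xi> c))\<^sup>2)
      = measure_pmf.expectation (F a) (\<lambda>y. (h y)\<^sup>2 + 2 * h y * ?E ?S + ?E (\<lambda>\<xi>. (?S \<xi>)\<^sup>2))"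
    unfolding split upd using int by (simp add: power2_sum add_ac)
  also have "\<dots> = measure_pmf.expectation (F a) (\<lambda>y. (h y)\<^sup>2) + 2 * m a * ?E ?S + ?E (\<lambda>\<xi>. (?S \<xi>)\<^sup>2)"
    using int' by (simp add: m_def)
  also have "\<dots> = (\<Sum>c\<in>insert a A. m c)\<^sup>2 + (\<Sum>c\<in>insert a A. v c)"
    using insert.hyps by (simp add: IH m_def v_def power2_sum)
  finally show ?case using 1 by blast
qed

lemma finite_set_move:
  assumes "finite I" "\<And>i. i \<in> I \<Longrightarrow> finite (set_pmf (F i))"
  shows "finite (set_pmf (move I F m))"
  unfolding move_def using assms by (auto intro!: finite_imageI finite_set_Pi_pmf)

text \<open>
  The arrivals weighted by \<open>\<phi>\<close> are the sum over all copies \<open>c\<close> of the value of \<open>\<phi>\<close> at the place reached by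
  \<open>c\<close>, counted as \<open>0\<close> if \<open>c\<close> dies. The copies being independent, \<open>sum_Pi_pmf_moments\<close> applies; each of
  the \<open>m i\<close> copies starting in \<open>i\<close> contributes the same mean \<open>Q \<phi> i\<close> and variance
  \<open>Q (\<phi>\<^sup>2) i - (Q \<phi> i)\<^sup>2\<close>.
\<close>

lemma move_moments:
  fixes \<phi> :: "nat \<Rightarrow> real"
  assumes I: "finite I" and J: "finite J"
    and supp: "\<And>i. i \<in> I \<Longrightarrow> set_pmf (F i) \<subseteq> insert None (Some ` J)"
  defines "Q \<equiv> \<lambda>\<psi> i. \<Sum>j\<in>J. pmf (F i) (Some j) * \<psi> j"
  shows "measure_pmf.expectation (move I F m) (\<lambda>z. \<Sum>j\<in>J. real (z j) * \<phi> j) = (\<Sum>i\<in>I. real (m i) * Q \<phi> i)"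
    and "measure_pmf.expectation (move I F m) (\<lambda>z. (\<Sum>j\<in>J. real (z j) * \<phi> j)\<^sup>2)
      = (\<Sum>i\<in>I. real (m i) * Q \<phi> i)\<^sup>2 + (\<Sum>i\<in>I. real (m i) * (Q (\<lambda>j. (\<phi> j)\<^sup>2) i - (Q \<phi> i)\<^sup>2))"
proof -
  define C where "C = (SIGMA i:I. {..<m i})"
  define h where "h x = (case x of None \<Rightarrow> 0 | Some j \<Rightarrow> if j \<in> J then \<phi> j else 0)" for x
  define G where "G = (\<lambda>c :: nat \<times> nat. F (fst c))"
  have C: "finite C" using I by (simp add: C_def)
  have fin: "finite (set_pmf (G c))" if "c \<in> C" for c
    using that J finite_subset[OF supp] by (auto simp: C_def G_def)
  have count: "(\<Sum>j\<in>J. real (card {c \<in> C. \<xi> c = Some j}) * \<phi> j) = (\<Sum>c\<in>C. h (\<xi> c))"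
    for \<xi> :: "nat \<times> nat \<Rightarrow> nat option"
  proof -
    have "real (card {c \<in> C. \<xi> c = Some j}) * \<phi> j = (\<Sum>c\<in>C. if \<xi> c = Some j then \<phi> j else 0)" for j
      using C by (simp add: sum.If_cases Int_def)
    then have "(\<Sum>j\<in>J. real (card {c \<in> C. \<xi> c = Some j}) * \<phi> j)
        = (\<Sum>j\<in>J. \<Sum>c\<in>C. if \<xi> c = Some j then \<phi> j else 0)"
      by (simp only:)
    also have "\<dots> = (\<Sum>c\<in>C. \<Sum>j\<in>J. if \<xi> c = Some j then \<phi> j else 0)"
      by (rule sum.swap)
    also have "\<dots> = (\<Sum>c\<in>C. h (\<xi> c))"
      using J by (intro sum.cong) (auto simp: h_def split: option.split)
    finally show ?thesis .
  qed
  have E: "measure_pmf.expectation (F i) (\<lambda>x. g (h x)) = Q (\<lambda>j. g (\<phi> j)) i"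
    if "i \<in> I" "g 0 = 0" for i and g :: "real \<Rightarrow> real"
  proof -
    have "measure_pmf.expectation (F i) (\<lambda>x. g (h x))
        = (\<Sum>x\<in>insert None (Some ` J). pmf (F i) x *\<^sub>R g (h x))"
      using J supp[OF that(1)] by (intro integral_measure_pmf) auto
    also have "\<dots> = Q (\<lambda>j. g (\<phi> j)) i"
      using J that(2) by (simp add: sum.reindex h_def Q_def)
    finally show ?thesis .
  qed
  have sum_C: "(\<Sum>c\<in>C. q (fst c)) = (\<Sum>i\<in>I. real (m i) * q i)" for q :: "nat \<Rightarrow> real"
    using sum.Sigma[of I "\<lambda>i. {..<m i}" "\<lambda>i l. q i"] I by (simp add: C_def case_prod_beta')
  have mv: "move I F m = map_pmf (\<lambda>\<xi> j. card {c \<in> C. \<xi> c = Some j}) (Pi_pmf C None G)"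
    by (simp add: move_def C_def G_def case_prod_beta')
  have m: "(\<Sum>c\<in>C. measure_pmf.expectation (G c) h) = (\<Sum>i\<in>I. real (m i) * Q \<phi> i)"
    using E[of _ "\<lambda>x. x"] by (subst sum_C[symmetric], intro sum.cong) (auto simp: G_def C_def)
  have v: "(\<Sum>c\<in>C. measure_pmf.expectation (G c) (\<lambda>x. (h x)\<^sup>2) - (measure_pmf.expectation (G c) h)\<^sup>2)
      = (\<Sum>i\<in>I. real (m i) * (Q (\<lambda>j. (\<phi> j)\<^sup>2) i - (Q \<phi> i)\<^sup>2))"
    using E[of _ "\<lambda>x. x"] E[of _ "\<lambda>x. x\<^sup>2"]
    by (subst sum_C[symmetric], intro sum.cong) (auto simp: G_def C_def)
  show "measure_pmf.expectation (move I F m) (\<lambda>z. \<Sum>j\<in>J. real (z j) * \<phi> j) = (\<Sum>i\<in>I. real (m i) * Q \<phi> i)"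
    using sum_Pi_pmf_moments[of C G None h, OF C fin] by (simp add: mv count m)
  show "measure_pmf.expectation (move I F m) (\<lambda>z. (\<Sum>j\<in>J. real (z j) * \<phi> j)\<^sup>2)
      = (\<Sum>i\<in>I. real (m i) * Q \<phi> i)\<^sup>2 + (\<Sum>i\<in>I. real (m i) * (Q (\<lambda>j. (\<phi> j)\<^sup>2) i - (Q \<phi> i)\<^sup>2))"
    using sum_Pi_pmf_moments[of C G None h, OF C fin] by (simp add: mv count m v)
qed


section \<open>The embedded chain\<close>

context multilevel_splitting
begin

definition visit :: "nat \<Rightarrow> nat \<Rightarrow> 'w set" where
  "visit k i = {\<omega> \<in> space (law S). killed_pos S k \<omega> = Some i}"

definition success :: "'w set" where
  "success = {\<omega> \<in> space (law S). hit_time S (levels S + 1) \<omega> < \<infinity>}"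

lemma finite_idx [simp]: "finite (idx S k)"
  by (simp add: idx_def)

lemma killed_pos_eq_Some_iff:
  "killed_pos S k \<omega> = Some i \<longleftrightarrow> pos S k \<omega> = i \<and> hit_time S k \<omega> < \<infinity>"
  by (auto simp: killed_pos_def)

lemma hit_time_0:
  assumes "\<omega> \<in> space (law S)"
  shows "hit_time S 0 \<omega> < \<infinity>"
proof -
  have "hit_time S 0 \<omega> \<le> ereal 0"
    unfolding hit_time_def using start[OF assms] front_0 by (intro Inf_lower) auto
  then show ?thesis by (rule le_less_trans) simp
qed

lemma pos_in_idx:
  assumes \<omega>: "\<omega> \<in> space (law S)" and k: "k \<le> levels S + 1" and hit: "hit_time S k \<omega> < \<infinity>"
  shows "pos S k \<omega> \<in> idx S k"
proof -
  define x where "x = traj S (real_of_ereal (hit_time S k \<omega>)) \<omega>"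
  have x: "x \<in> front S k"
    unfolding x_def by (rule hit_attained[OF \<omega> k hit])
  have "\<exists>!i. i \<in> idx S k \<and> x \<in> cell S k i"
  proof (cases "1 \<le> k \<and> k \<le> levels S")
    case True
    then have "\<exists>i\<in>{1..cells S}. x \<in> piece S k i"
      using x partition_Un by blast
    moreover have "i = j" if "i \<in> {1..cells S}" "j \<in> {1..cells S}" "x \<in> piece S k i" "x \<in> piece S k j" for i j
      using that partition_disjoint[of k] True unfolding disjoint_family_on_def by blast
    ultimately show ?thesis
      using True unfolding idx_def cell_def by auto
  next
    case False
    then show ?thesis using x by (auto simp: idx_def cell_def)
  qed
  from theI'[OF this] show ?thesis
    by (simp add: pos_def x_def)
qed

lemma sets_visit: "k \<le> levels S + 1 \<Longrightarrow> visit k i \<in> events"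
  using pos_sets[of k i] by (simp add: visit_def killed_pos_eq_Some_iff)

lemma visit_0: "visit 0 1 = space (law S)"
  using hit_time_0 pos_in_idx[of _ 0] by (auto simp: visit_def killed_pos_eq_Some_iff idx_def)

lemma success_eq: "success = visit (levels S + 1) 1"
  using pos_in_idx[of _ "levels S + 1"]
  by (auto simp: success_def visit_def killed_pos_eq_Some_iff idx_def)

lemma sets_success: "success \<in> events"
  by (simp add: success_eq sets_visit)

lemma hit_prob_eq: "hit_prob S = prob success"
  by (simp add: hit_prob_def success_def)

text \<open>
  The conventions at levels \<open>0\<close> and \<open>M + 1\<close> are consistent with the model: the starting point is visited
  surely, and reaching the target means visiting the only cell of level \<open>M + 1\<close>. Hence
  \<^const>\<open>gam\<close>, \<^const>\<open>f_val\<close> and \<^const>\<open>kern\<close> have one formula in terms of visits, valid at every level,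
  and the forward and backward equations below hold without distinction of the end levels.
\<close>

lemma gam_eq:
  assumes "k \<le> levels S + 1" "i \<in> idx S k"
  shows "gam S k i = prob (visit k i)"
proof -
  consider "k = 0" | "k = levels S + 1" "k \<noteq> 0" | "k \<noteq> 0" "k \<noteq> levels S + 1"
    by blast
  then show ?thesis
  proof cases
    case 1
    then show ?thesis using assms visit_0 by (simp add: gam_def idx_def prob_space)
  next
    case 2
    then show ?thesis using assms by (simp add: gam_def idx_def hit_prob_eq success_eq)
  next
    case 3
    then show ?thesis by (simp add: gam_def visit_def killed_pos_eq_Some_iff)
  qed
qed

lemma f_val_eq:
  assumes "k \<le> levels S + 1" "i \<in> idx S k"
  shows "f_val S k i = prob (success \<inter> visit k i) / prob (visit k i)"
proof -
  consider "k = 0" | "k = levels S + 1" "k \<noteq> 0" | "k \<noteq> 0" "k \<noteq> levels S + 1"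
    by blast
  then show ?thesis
  proof cases
    case 1
    then have "i = 1" using assms by (simp add: idx_def)
    moreover have "success \<inter> space (law S) = success"
      by (auto simp: success_def)
    ultimately show ?thesis using 1 visit_0 by (simp add: f_val_def hit_prob_eq prob_space)
  next
    case 2
    then have "i = 1" using assms by (simp add: idx_def)
    moreover have "prob (visit (levels S + 1) 1) \<noteq> 0"
      using gam1_nonzero[of "levels S + 1"] levels_pos
      by (simp add: gam_op_def idx_def gam_eq)
    ultimately show ?thesis using 2 by (simp add: f_val_def success_eq)
  next
    case 3
    have "{\<omega> \<in> space (law S). hit_time S (levels S + 1) \<omega> < \<infinity> \<and> pos S k \<omega> = i \<and> hit_time S k \<omega> < \<infinity>}
        = success \<inter> visit k i"
      by (auto simp: success_def visit_def killed_pos_eq_Some_iff)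
    then show ?thesis
      using 3 by (simp add: f_val_def cond_prob_def visit_def killed_pos_eq_Some_iff)
  qed
qed

lemma kern_eq:
  assumes "k \<le> levels S" "i \<in> idx S k" "j \<in> idx S (k + 1)"
  shows "kern S (k + 1) i j = prob (visit (k + 1) j \<inter> visit k i) / prob (visit k i)"
proof -
  consider "k = 0" | "k = levels S" "k \<noteq> 0" | "k \<noteq> 0" "k \<noteq> levels S"
    by blast
  then show ?thesis
  proof cases
    case 1
    then have i: "i = 1" using assms by (simp add: idx_def)
    have "visit 1 j \<inter> space (law S) = visit 1 j"
      by (auto simp: visit_def)
    then show ?thesis
      using 1 visit_0 i assms gam_eq[of 1 j] levels_pos by (simp add: kern_def prob_space)
  next
    case 2
    then have "j = 1" using assms by (simp add: idx_def)
    then show ?thesis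
      using 2 assms f_val_eq[of k i] success_eq by (simp add: kern_def)
  next
    case 3
    have "{\<omega> \<in> space (law S). (pos S (Suc k) \<omega> = j \<and> hit_time S (Suc k) \<omega> < \<infinity>)
             \<and> pos S k \<omega> = i \<and> hit_time S k \<omega> < \<infinity>}
        = visit (Suc k) j \<inter> visit k i"
      by (auto simp: visit_def killed_pos_eq_Some_iff)
    then show ?thesis
      using 3 by (simp add: kern_def cond_prob_def visit_def killed_pos_eq_Some_iff)
  qed
qed

text \<open>
  A particle that reaches a level has passed through some cell of each earlier level, so an event
  contained in a visit to a later level can be decomposed according to the cell visited before.
\<close>

lemma visit_later_cases:
  assumes "k \<le> l" "l \<le> levels S + 1" "\<omega> \<in> visit l j"
  shows "\<exists>i\<in>idx S k. \<omega> \<in> visit k i"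
proof -
  have \<omega>: "\<omega> \<in> space (law S)" and "hit_time S l \<omega> < \<infinity>"
    using assms(3) by (auto simp: visit_def killed_pos_eq_Some_iff)
  then have "hit_time S k \<omega> < \<infinity>"
    using hit_previous[OF \<omega> assms(1,2)] by (auto intro: le_less_trans)
  then show ?thesis
    using pos_in_idx[OF \<omega>, of k] assms(1,2) \<omega>
    by (intro bexI[of _ "pos S k \<omega>"]) (auto simp: visit_def killed_pos_eq_Some_iff)
qed

lemma prob_split_visit:
  assumes k: "k \<le> l" "l \<le> levels S + 1" and A: "A \<in> events" "A \<subseteq> visit l j"
  shows "prob A = (\<Sum>i\<in>idx S k. prob (A \<inter> visit k i))"
proof -
  have "A = (\<Union>i\<in>idx S k. A \<inter> visit k i)"
    using visit_later_cases[OF k] A(2) by blast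
  then have "prob A = prob (\<Union>i\<in>idx S k. A \<inter> visit k i)"
    by simp
  also have "\<dots> = (\<Sum>i\<in>idx S k. prob (A \<inter> visit k i))"
    by (rule finite_measure_finite_Union)
       (use A k sets_visit in \<open>auto simp: disjoint_family_on_def visit_def\<close>)
  finally show ?thesis .
qed

lemma prob_visit_kern:
  assumes "k \<le> levels S" "i \<in> idx S k" "j \<in> idx S (k + 1)"
  shows "prob (visit (k + 1) j \<inter> visit k i) = prob (visit k i) * kern S (k + 1) i j"
proof (cases "prob (visit k i) = 0")
  case True
  have "prob (visit (k + 1) j \<inter> visit k i) \<le> prob (visit k i)"
    using assms by (intro finite_measure_mono) (auto intro: sets_visit)
  then show ?thesis using True measure_nonneg[of "law S"] by (simp add: order_antisym)
qed (use kern_eq[OF assms] in simp)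

lemma gam_Suc:
  assumes "k \<le> levels S" "j \<in> idx S (k + 1)"
  shows "gam S (k + 1) j = (\<Sum>i\<in>idx S k. gam S k i * kern S (k + 1) i j)"
proof -
  have "gam S (k + 1) j = (\<Sum>i\<in>idx S k. prob (visit (k + 1) j \<inter> visit k i))"
    using assms prob_split_visit[of k "k + 1" "visit (k + 1) j" j]
    by (simp add: gam_eq sets_visit)
  also have "\<dots> = (\<Sum>i\<in>idx S k. gam S k i * kern S (k + 1) i j)"
    using assms prob_visit_kern by (intro sum.cong) (auto simp: gam_eq)
  finally show ?thesis .
qed

text \<open>
  \<open>\<gamma>\<^sub>k P\<^sub>k\<^sub>+\<^sub>1 = \<gamma>\<^sub>k\<^sub>+\<^sub>1\<close>. This forward equation is total probability over the cell visited at level \<open>k\<close>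
  and involves no history beyond that cell.
\<close>

lemma gam_op_P_op:
  assumes "k \<le> levels S"
  shows "gam_op S k (P_op S (k + 1) \<phi>) = gam_op S (k + 1) \<phi>"
proof -
  have "gam_op S k (P_op S (k + 1) \<phi>)
      = (\<Sum>j\<in>idx S (k + 1). (\<Sum>i\<in>idx S k. gam S k i * kern S (k + 1) i j) * \<phi> j)"
    unfolding gam_op_def P_op_def sum_distrib_left sum_distrib_right
    by (subst sum.swap) (simp add: mult.assoc)
  also have "\<dots> = gam_op S (k + 1) \<phi>"
    using gam_Suc[OF assms] by (simp add: gam_op_def)
  finally show ?thesis .
qed

text \<open>
  Only histories of living particles are recorded: a particle killed before level \<open>k\<close> can neither
  visit level \<open>k\<close> nor succeed. The lower end \<open>l\<close> is a parameter so that the past can be forgotten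
  one level at a time.
\<close>

definition history :: "nat \<Rightarrow> nat \<Rightarrow> (nat \<Rightarrow> nat) \<Rightarrow> 'w set" where
  "history l k h = {\<omega> \<in> space (law S). \<forall>m\<in>{l..k}. killed_pos S m \<omega> = Some (h m)}"

lemma history_self: "history k k h = visit k (h k)"
  by (auto simp: history_def visit_def)

lemma history_Suc_right:
  "l \<le> Suc k \<Longrightarrow> history l (Suc k) h = history l k h \<inter> visit (Suc k) (h (Suc k))"
  by (auto simp: history_def visit_def le_Suc_eq)

lemma history_cong: "(\<And>m. l \<le> m \<Longrightarrow> m \<le> k \<Longrightarrow> h m = h' m) \<Longrightarrow> history l k h = history l k h'"
  by (auto simp: history_def)

lemma sets_history:
  assumes "l \<le> k" "k \<le> levels S + 1"
  shows "history l k h \<in> events"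
proof -
  have "history l k h = (\<Inter>m\<in>{l..k}. visit m (h m))"
    using assms(1) by (auto simp: history_def visit_def)
  also have "\<dots> \<in> events"
    using assms by (intro sets.finite_INT sets_visit) auto
  finally show ?thesis .
qed

lemma history_subset: "l \<le> k \<Longrightarrow> history l k h \<subseteq> visit k (h k)"
  by (auto simp: history_def visit_def)

text \<open>
  The Markov property in product form, which remains true for histories of probability \<open>0\<close>.
\<close>

lemma prob_history_step:
  assumes k: "k \<le> levels S" and i: "h k \<in> idx S k" and j: "j \<in> idx S (k + 1)"
  shows "prob (history 0 k h \<inter> visit (k + 1) j) = prob (history 0 k h) * kern S (k + 1) (h k) j"
proof (cases "prob (history 0 k h) = 0")
  case True
  have "prob (history 0 k h \<inter> visit (k + 1) j) \<le> prob (history 0 k h)"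
    using k by (intro finite_measure_mono) (auto intro: sets_history)
  then show ?thesis using True measure_nonneg[of "law S"] by (simp add: order_antisym)
next
  case False
  have t: "history 0 k h = {\<omega> \<in> space (law S). \<forall>m\<le>k. killed_pos S m \<omega> = (Some \<circ> h) m}"
    by (auto simp: history_def)
  have "prob (history 0 k h) > 0"
    using False measure_nonneg[of "law S"] by (simp add: less_le)
  then have "\<P>(\<omega> in law S. killed_pos S (k + 1) \<omega> = Some j \<bar> \<forall>m\<le>k. killed_pos S m \<omega> = (Some \<circ> h) m)
        = \<P>(\<omega> in law S. killed_pos S (k + 1) \<omega> = Some j \<bar> killed_pos S k \<omega> = (Some \<circ> h) k)"
    using markov[OF k] unfolding t by blast
  moreover have "{\<omega> \<in> space (law S). killed_pos S (k + 1) \<omega> = Some j \<and> (\<forall>m\<le>k. killed_pos S m \<omega> = (Some \<circ> h) m)}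
      = history 0 k h \<inter> visit (k + 1) j"
    by (auto simp: t visit_def)
  moreover have "{\<omega> \<in> space (law S). killed_pos S (k + 1) \<omega> = Some j \<and> killed_pos S k \<omega> = (Some \<circ> h) k}
      = visit (k + 1) j \<inter> visit k (h k)"
    by (auto simp: visit_def)
  moreover have "{\<omega> \<in> space (law S). killed_pos S k \<omega> = (Some \<circ> h) k} = visit k (h k)"
    by (simp add: visit_def)
  ultimately have "prob (history 0 k h \<inter> visit (k + 1) j) / prob (history 0 k h)
      = prob (visit (k + 1) j \<inter> visit k (h k)) / prob (visit k (h k))"
    unfolding cond_prob_def t by simp
  then show ?thesis
    using False kern_eq[OF k i j] by (simp add: field_simps)
qed

text \<open>
  If from level \<open>k + 1\<close> on the success probability depends on the present cell only, the same holds
  from level \<open>k\<close> on, with value \<open>P\<^sub>k\<^sub>+\<^sub>1(f\<^sub>k\<^sub>+\<^sub>1)\<close>: successful particles are split according to their next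
  cell. The hypothesis is needed for complete histories, because \<open>f\<^sub>k\<^sub>+\<^sub>1\<close> conditions on the cell at level
  \<open>k + 1\<close> alone whereas here the cell at level \<open>k\<close> is also known.
\<close>

lemma success_history_step:
  assumes k: "k \<le> levels S" and i: "h k \<in> idx S k"
    and IH: "\<And>h'. h' (k + 1) \<in> idx S (k + 1) \<Longrightarrow>
      prob (success \<inter> history 0 (k + 1) h') = prob (history 0 (k + 1) h') * f_val S (k + 1) (h' (k + 1))"
  shows "prob (success \<inter> history 0 k h) = prob (history 0 k h) * P_op S (k + 1) (f_val S (k + 1)) (h k)"
proof -
  have tr: "history 0 (k + 1) (h(k + 1 := j)) = history 0 k h \<inter> visit (k + 1) j" for j
    using history_Suc_right[of 0 k "h(k + 1 := j)"] history_cong[of 0 k "h(k + 1 := j)" h] by simp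
  have "prob (success \<inter> history 0 k h) = (\<Sum>j\<in>idx S (k + 1). prob (success \<inter> history 0 k h \<inter> visit (k + 1) j))"
    using k by (intro prob_split_visit[where l = "levels S + 1" and j = 1])
               (auto intro!: sets.Int sets_history sets_visit simp: success_eq)
  also have "\<dots> = (\<Sum>j\<in>idx S (k + 1). prob (history 0 k h \<inter> visit (k + 1) j) * f_val S (k + 1) j)"
  proof (intro sum.cong refl)
    fix j assume "j \<in> idx S (k + 1)"
    then show "prob (success \<inter> history 0 k h \<inter> visit (k + 1) j)
        = prob (history 0 k h \<inter> visit (k + 1) j) * f_val S (k + 1) j"
      using IH[of "h(k + 1 := j)"] unfolding tr by (simp add: Int_assoc)
  qed
  also have "\<dots> = (\<Sum>j\<in>idx S (k + 1). prob (history 0 k h) * (kern S (k + 1) (h k) j * f_val S (k + 1) j))"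
    using prob_history_step[of k h, OF k i] by (intro sum.cong) auto
  also have "\<dots> = prob (history 0 k h) * P_op S (k + 1) (f_val S (k + 1)) (h k)"
    by (simp add: P_op_def sum_distrib_left)
  finally show ?thesis .
qed

text \<open>
  A conditional success probability common to all complete histories ending in the cell \<open>i\<close> survives
  summation over the earlier cells, hence also holds given the present cell alone (\<open>l = k\<close>).
\<close>

lemma forget_past:
  assumes lk: "l \<le> k" "k \<le> levels S + 1"
    and full: "\<And>h. h k = i \<Longrightarrow> prob (success \<inter> history 0 k h) = prob (history 0 k h) * c"
    and h: "h k = i"
  shows "prob (success \<inter> history l k h) = prob (history l k h) * c"
  using lk(1) h
proof (induction l arbitrary: h)
  case 0
  then show ?case by (simp add: full)
next
  case (Suc l)
  have tr: "history l k (h(l := a)) = history (Suc l) k h \<inter> visit l a" for a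
    using Suc.prems unfolding history_def visit_def
    by (auto simp: Suc_le_eq split: if_splits dest: le_neq_implies_less)
  have "prob (success \<inter> history (Suc l) k h) = (\<Sum>a\<in>idx S l. prob (success \<inter> history (Suc l) k h \<inter> visit l a))"
    using Suc.prems lk by (intro prob_split_visit[where l = k and j = i])
      (auto intro!: sets.Int sets_history sets_success dest: history_subset[THEN subsetD, of "Suc l" k _ h])
  also have "\<dots> = (\<Sum>a\<in>idx S l. prob (history (Suc l) k h \<inter> visit l a) * c)"
  proof (intro sum.cong refl)
    fix a
    have "prob (success \<inter> history l k (h(l := a))) = prob (history l k (h(l := a))) * c"
      using Suc.prems by (intro Suc.IH) auto
    then show "prob (success \<inter> history (Suc l) k h \<inter> visit l a) = prob (history (Suc l) k h \<inter> visit l a) * c"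
      by (simp add: tr Int_assoc del: fun_upd_apply)
  qed
  also have "\<dots> = prob (history (Suc l) k h) * c"
    unfolding sum_distrib_right[symmetric]
    using Suc.prems lk prob_split_visit[of l k "history (Suc l) k h" i] history_subset[of "Suc l" k h]
    by (simp add: sets_history)
  finally show ?case .
qed

text \<open>
  The two facts are proved by one downward induction: the backward equation at level \<open>k\<close> identifies
  the common value obtained from the histories with \<open>f\<^sub>k\<close>, which is what the step to
  level \<open>k - 1\<close> requires.
\<close>

lemma success_history_and_f_val:
  assumes "k \<le> levels S + 1"
  shows "(\<forall>h. h k \<in> idx S k \<longrightarrow> prob (success \<inter> history 0 k h) = prob (history 0 k h) * f_val S k (h k))
    \<and> (k \<le> levels S \<longrightarrow> (\<forall>i\<in>idx S k. P_op S (k + 1) (f_val S (k + 1)) i = f_val S k i))"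
  using assms
proof (induction k rule: inc_induct)
  case base
  have "success \<inter> history 0 (levels S + 1) h = history 0 (levels S + 1) h"
    if "h (levels S + 1) \<in> idx S (levels S + 1)" for h
    using history_subset[of 0 "levels S + 1" h] that by (auto simp: success_eq idx_def)
  then show ?case by (simp add: f_val_def)
next
  case (step k)
  then have k: "k \<le> levels S" by simp
  let ?c = "P_op S (k + 1) (f_val S (k + 1))"
  have full: "prob (success \<inter> history 0 k h) = prob (history 0 k h) * ?c (h k)" if "h k \<in> idx S k" for h
    using step.IH that by (intro success_history_step k) auto
  have c: "?c i = f_val S k i" if i: "i \<in> idx S k" for i
  proof (cases "prob (visit k i) = 0")
    case True
    \<comment> \<open>Both sides vanish, as conditional probabilities given a null event are \<open>0\<close>.\<close>
    then show ?thesis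
      using k i kern_eq[OF k i] f_val_eq[of k i] by (simp add: P_op_def)
  next
    case False
    have "prob (success \<inter> history k k (\<lambda>_. i)) = prob (history k k (\<lambda>_. i)) * ?c i"
      by (rule forget_past[where i = i]) (use k full i in auto)
    then show ?thesis
      using False k i f_val_eq[of k i] by (simp add: history_self)
  qed
  show ?case using full c by auto
qed

lemma P_op_f_val:
  "k \<le> levels S \<Longrightarrow> i \<in> idx S k \<Longrightarrow> P_op S (k + 1) (f_val S (k + 1)) i = f_val S k i"
  using success_history_and_f_val[of k] by auto

lemma gam_op_f_val:
  "n \<le> levels S + 1 \<Longrightarrow> gam_op S n (f_val S n) = hit_prob S"
proof (induction n)
  case 0
  then show ?case by (simp add: gam_op_def idx_def gam_def f_val_def)
next
  case (Suc n)
  then have n: "n \<le> levels S" by simp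
  have "gam_op S (Suc n) (f_val S (Suc n)) = gam_op S n (P_op S (Suc n) (f_val S (Suc n)))"
    using gam_op_P_op[OF n] by simp
  also have "\<dots> = gam_op S n (f_val S n)"
    using P_op_f_val[OF n] by (simp add: gam_op_def)
  finally show ?case using Suc by simp
qed

lemma gam1_neq_0: "k \<le> levels S + 1 \<Longrightarrow> gam1 S k \<noteq> 0"
  using gam1_nonzero[of k] by (cases k) (auto simp: gam_op_def idx_def gam_def)

lemma hit_prob_neq_0: "hit_prob S \<noteq> 0"
  using gam1_neq_0[of "levels S + 1"] gam_op_f_val[of "levels S + 1"] by (simp add: gam_op_def f_val_def)


section \<open>Moments of the particle counts\<close>

text \<open>This is \<open>Z\<^sub>n(\<phi>)\<close>, the counts \<open>z\<close> at level \<open>n\<close> being read as a measure on the cells.\<close>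

definition count_op :: "nat \<Rightarrow> (nat \<Rightarrow> nat) \<Rightarrow> (nat \<Rightarrow> real) \<Rightarrow> real" where
  "count_op n z \<phi> = (\<Sum>i\<in>idx S n. real (z i) * \<phi> i)"

lemma pmf_fate_Some:
  "n \<le> levels S \<Longrightarrow> j \<in> idx S (Suc n) \<Longrightarrow> pmf (fate S (Suc n) i) (Some j) = kern S (Suc n) i j"
  using pmf_fate[of "Suc n" i "Some j"] by simp

lemma set_fate:
  "n \<le> levels S \<Longrightarrow> set_pmf (fate S (Suc n) i) \<subseteq> insert None (Some ` idx S (Suc n))"
  by (rule subsetI, case_tac x) (auto simp: set_pmf_eq pmf_fate split: if_splits)

lemma finite_set_fate: "n \<le> levels S \<Longrightarrow> finite (set_pmf (fate S (Suc n) i))"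
  using finite_subset[OF set_fate] by auto

lemma move_fate_moments:
  assumes n: "n \<le> levels S"
  defines "P \<equiv> P_op S (Suc n)"
  shows "measure_pmf.expectation (move (idx S n) (fate S (Suc n)) m) (\<lambda>z. count_op (Suc n) z \<phi>)
      = count_op n m (P \<phi>)"
    and "measure_pmf.expectation (move (idx S n) (fate S (Suc n)) m) (\<lambda>z. (count_op (Suc n) z \<phi>)\<^sup>2)
      = (count_op n m (P \<phi>))\<^sup>2 + count_op n m (Gam_diag S (Suc n) \<phi>)"
proof -
  have Q: "(\<Sum>j\<in>idx S (Suc n). pmf (fate S (Suc n) i) (Some j) * \<psi> j) = P \<psi> i" for \<psi> i
    using pmf_fate_Some[OF n] by (simp add: P_def P_op_def)
  note M = move_moments[where F = "fate S (Suc n)", OF finite_idx finite_idx set_fate[OF n], unfolded Q]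
  show "measure_pmf.expectation (move (idx S n) (fate S (Suc n)) m) (\<lambda>z. count_op (Suc n) z \<phi>)
      = count_op n m (P \<phi>)"
    using M(1) by (simp add: count_op_def)
  show "measure_pmf.expectation (move (idx S n) (fate S (Suc n)) m) (\<lambda>z. (count_op (Suc n) z \<phi>)\<^sup>2)
      = (count_op n m (P \<phi>))\<^sup>2 + count_op n m (Gam_diag S (Suc n) \<phi>)"
    using M(2) by (simp add: count_op_def Gam_op_def P_def power2_eq_square)
qed

lemma finite_set_Z:
  "n \<le> levels S + 1 \<Longrightarrow> finite (set_pmf (Z_pmf S N R n))"
  by (induction n) (auto intro!: finite_set_move finite_set_fate)

lemma Z_moments_Suc:
  fixes R :: "nat \<Rightarrow> nat"
  assumes n: "n \<le> levels S"
  defines "r \<equiv> if n = 0 then 1 else real (R n)" and "P \<equiv> P_op S (Suc n)"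
  shows "measure_pmf.expectation (Z_pmf S N R (Suc n)) (\<lambda>z. count_op (Suc n) z \<phi>)
      = r * measure_pmf.expectation (Z_pmf S N R n) (\<lambda>z. count_op n z (P \<phi>))"
    and "measure_pmf.expectation (Z_pmf S N R (Suc n)) (\<lambda>z. (count_op (Suc n) z \<phi>)\<^sup>2)
      = r\<^sup>2 * measure_pmf.expectation (Z_pmf S N R n) (\<lambda>z. (count_op n z (P \<phi>))\<^sup>2)
        + r * measure_pmf.expectation (Z_pmf S N R n) (\<lambda>z. count_op n z (Gam_diag S (Suc n) \<phi>))"
proof -
  have fin: "finite (set_pmf (Z_pmf S N R n))"
    using n by (intro finite_set_Z) auto
  have int: "integrable (measure_pmf (Z_pmf S N R n)) f" for f :: "_ \<Rightarrow> real"
    by (rule integrable_measure_pmf_finite[OF fin])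
  have dup: "count_op n (\<lambda>i. if n = 0 then z i else R n * z i) \<psi> = r * count_op n z \<psi>" for z \<psi>
    by (simp add: count_op_def r_def sum_distrib_left mult.assoc)
  have bind: "measure_pmf.expectation (Z_pmf S N R (Suc n)) g
      = measure_pmf.expectation (Z_pmf S N R n) (\<lambda>z. measure_pmf.expectation
          (move (idx S n) (fate S (Suc n)) (\<lambda>i. if n = 0 then z i else R n * z i)) g)" for g :: "_ \<Rightarrow> real"
    unfolding Z_pmf.simps
    by (rule expectation_bind_pmf_finite) (use n fin in \<open>auto intro!: finite_set_move finite_set_fate\<close>)
  show "measure_pmf.expectation (Z_pmf S N R (Suc n)) (\<lambda>z. count_op (Suc n) z \<phi>)
      = r * measure_pmf.expectation (Z_pmf S N R n) (\<lambda>z. count_op n z (P \<phi>))"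
    unfolding bind move_fate_moments[OF n] dup by (simp add: P_def)
  show "measure_pmf.expectation (Z_pmf S N R (Suc n)) (\<lambda>z. (count_op (Suc n) z \<phi>)\<^sup>2)
      = r\<^sup>2 * measure_pmf.expectation (Z_pmf S N R n) (\<lambda>z. (count_op n z (P \<phi>))\<^sup>2)
        + r * measure_pmf.expectation (Z_pmf S N R n) (\<lambda>z. count_op n z (Gam_diag S (Suc n) \<phi>))"
    unfolding bind move_fate_moments[OF n] dup using int by (simp add: P_def power_mult_distrib)
qed

lemma rep_pos:
  assumes "1 \<le> N" "\<forall>k\<in>{1..levels S}. 1 \<le> R k" "k \<le> levels S"
  shows "0 < rep N R k"
  using assms(3,1,2) by (induction k) (auto simp: Suc_le_eq)

lemma rep_duplication:
  "(if n = 0 then 1 else real (R n)) * real (rep N R (n - 1)) = real (rep N R n)"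
  by (cases n) auto

text \<open>
  For \<open>n \<ge> 1\<close> the normalisation of \<open>Z\<^sub>n\<close> is \<open>r\<^sub>n\<^sub>-\<^sub>1\<close>, as the particles at level \<open>n\<close> are not yet duplicated. The
  initial one is \<open>N = r\<^sub>0\<close>; truncated subtraction covers both by the one expression \<open>rep N R (n - 1)\<close>.
\<close>

lemma Z_mean:
  assumes "n \<le> levels S + 1"
  shows "measure_pmf.expectation (Z_pmf S N R n) (\<lambda>z. count_op n z \<phi>) = real (rep N R (n - 1)) * gam_op S n \<phi>"
  using assms
proof (induction n arbitrary: \<phi>)
  case 0
  then show ?case by (simp add: count_op_def gam_op_def idx_def gam_def)
next
  case (Suc n)
  then have n: "n \<le> levels S" by simp
  have "measure_pmf.expectation (Z_pmf S N R (Suc n)) (\<lambda>z. count_op (Suc n) z \<phi>)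
      = (if n = 0 then 1 else real (R n)) * (real (rep N R (n - 1)) * gam_op S n (P_op S (Suc n) \<phi>))"
    unfolding Z_moments_Suc(1)[OF n] using Suc.IH n by simp
  also have "\<dots> = real (rep N R n) * gam_op S (Suc n) \<phi>"
    unfolding mult.assoc[symmetric] rep_duplication using gam_op_P_op[OF n] by simp
  finally show ?case by simp
qed

text \<open>
  For the test functions \<open>f\<^sub>n\<close> the conditional mean of \<open>Z\<^sub>n\<^sub>+\<^sub>1(f\<^sub>n\<^sub>+\<^sub>1)\<close> is a multiple of \<open>Z\<^sub>n(f\<^sub>n)\<close>, by the backward
  equation. Hence \<open>Z\<^sub>n(f\<^sub>n)\<close>, divided by \<open>rep N R (n - 1)\<close>, is a martingale with initial value \<open>p\<close>, and its second moment
  grows at each level exactly by the mean conditional variance.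
\<close>

lemma Z_second_moment:
  assumes "n \<le> levels S + 1" and N: "1 \<le> N" and R: "\<forall>k\<in>{1..levels S}. 1 \<le> R k"
  shows "measure_pmf.expectation (Z_pmf S N R n) (\<lambda>z. (count_op n z (f_val S n))\<^sup>2)
    = (real (rep N R (n - 1)))\<^sup>2 * ((hit_prob S)\<^sup>2
        + (\<Sum>i<n. 1 / real (rep N R i) * gam_op S i (Gam_diag S (Suc i) (f_val S (Suc i)))))"
  using assms(1)
proof (induction n)
  case 0
  then show ?case by (simp add: count_op_def idx_def f_val_def power_mult_distrib)
next
  case (Suc n)
  then have n: "n \<le> levels S" by simp
  let ?r = "if n = 0 then 1 else real (R n)"
  let ?G = "\<lambda>i. gam_op S i (Gam_diag S (Suc i) (f_val S (Suc i)))"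
  let ?T = "\<lambda>n. \<Sum>i<n. 1 / real (rep N R i) * ?G i"
  have "count_op n z (P_op S (Suc n) (f_val S (Suc n))) = count_op n z (f_val S n)" for z
    using P_op_f_val[OF n] by (simp add: count_op_def)
  then have "measure_pmf.expectation (Z_pmf S N R (Suc n)) (\<lambda>z. (count_op (Suc n) z (f_val S (Suc n)))\<^sup>2)
      = ?r\<^sup>2 * ((real (rep N R (n - 1)))\<^sup>2 * ((hit_prob S)\<^sup>2 + ?T n)) + ?r * (real (rep N R (n - 1)) * ?G n)"
    unfolding Z_moments_Suc(2)[OF n] using Suc.IH n Z_mean[of n N R] by simp
  also have "\<dots> = (real (rep N R n))\<^sup>2 * ((hit_prob S)\<^sup>2 + ?T n) + real (rep N R n) * ?G n"
    by (subst (1 2) rep_duplication[symmetric]) (simp only: power_mult_distrib distrib_left mult.assoc)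
  also have "\<dots> = (real (rep N R n))\<^sup>2 * ((hit_prob S)\<^sup>2 + ?T (Suc n))"
    using rep_pos[OF N R n] by (simp add: field_simps power2_eq_square)
  finally show ?case by simp
qed

lemma p_hat_var_Gam:
  assumes N: "1 \<le> N" and R: "\<forall>k\<in>{1..levels S}. 1 \<le> R k"
  shows "p_hat_var S N R
    = (\<Sum>i\<le>levels S. 1 / real (rep N R i) * gam_op S i (Gam_diag S (i + 1) (f_val S (i + 1))))"
proof -
  let ?M = "levels S"
  let ?Z = "Z_pmf S N R (?M + 1)"
  let ?r = "real (rep N R ?M)"
  have pos: "?r \<noteq> 0"
    using rep_pos[OF N R, of ?M] by simp
  have int: "integrable (measure_pmf ?Z) f" for f :: "_ \<Rightarrow> real"
    by (rule integrable_measure_pmf_finite) (rule finite_set_Z, simp)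
  have ph: "p_hat S N R z = count_op (?M + 1) z (f_val S (?M + 1)) / ?r" for z
    by (simp add: p_hat_def count_op_def idx_def f_val_def)
  have 1: "measure_pmf.expectation ?Z (p_hat S N R) = hit_prob S"
    unfolding ph using Z_mean[of "?M + 1" N R "f_val S (?M + 1)"] gam_op_f_val[of "?M + 1"] pos by simp
  have 2: "measure_pmf.expectation ?Z (\<lambda>z. (p_hat S N R z)\<^sup>2) = (hit_prob S)\<^sup>2
      + (\<Sum>i<?M + 1. 1 / real (rep N R i) * gam_op S i (Gam_diag S (Suc i) (f_val S (Suc i))))"
    unfolding ph power_divide using Z_second_moment[OF _ N R, of "?M + 1"] pos by simp
  have "p_hat_var S N R
      = measure_pmf.expectation ?Z (\<lambda>z. (p_hat S N R z)\<^sup>2) - (measure_pmf.expectation ?Z (p_hat S N R))\<^sup>2"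
    unfolding p_hat_var_def by (rule measure_pmf.variance_eq) (rule int)+
  then show ?thesis
    unfolding 1 2 by (simp add: lessThan_Suc_atMost)
qed


section \<open>The coefficient of variation\<close>

text \<open>
  By the backward equation the subtracted square in \<open>\<Gamma>\<^sub>k\<^sub>+\<^sub>1(f\<^sub>k\<^sub>+\<^sub>1)\<close> is \<open>f\<^sub>k\<^sup>2\<close>, and by the forward equation \<open>\<gamma>\<^sub>k\<close>
  turns the other term into \<open>\<gamma>\<^sub>k\<^sub>+\<^sub>1(f\<^sub>k\<^sub>+\<^sub>1\<^sup>2)\<close>; the terms of the variance are thus increments.
\<close>

lemma gam_op_Gam_diag:
  assumes k: "k \<le> levels S"
  shows "gam_op S k (Gam_diag S (k + 1) (f_val S (k + 1)))
    = gam_op S (k + 1) (\<lambda>i. (f_val S (k + 1) i)\<^sup>2) - gam_op S k (\<lambda>i. (f_val S k i)\<^sup>2)"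
proof -
  have "gam_op S k (Gam_diag S (k + 1) (f_val S (k + 1)))
      = gam_op S k (P_op S (k + 1) (\<lambda>j. (f_val S (k + 1) j)\<^sup>2)) - gam_op S k (\<lambda>i. (f_val S k i)\<^sup>2)"
    using P_op_f_val[OF k]
    by (simp add: gam_op_def Gam_op_def power2_eq_square sum_subtractf right_diff_distrib)
  then show ?thesis by (simp only: gam_op_P_op[OF k])
qed

lemma mu_op_eq: "mu_op S k \<phi> = gam_op S k \<phi> / gam1 S k"
  by (simp add: mu_op_def mu_def gam_op_def sum_divide_distrib)

text \<open>The squared coefficient of variation of \<open>f\<^sub>k\<close> under \<open>\<mu>\<^sub>k\<close>.\<close>

definition cv2 :: "nat \<Rightarrow> real" where
  "cv2 k = mu_var S k (f_val S k) / (mu_op S k (f_val S k))\<^sup>2"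

text \<open>
  A second moment is variance plus squared mean, and \<open>\<mu>\<^sub>k(f\<^sub>k) = p / \<gamma>\<^sub>k(1)\<close>.
\<close>

lemma gam_op_f_val_sq:
  assumes "k \<le> levels S + 1"
  shows "gam_op S k (\<lambda>i. (f_val S k i)\<^sup>2) / (hit_prob S)\<^sup>2 = (1 + cv2 k) / gam1 S k"
  using gam1_neq_0[OF assms] hit_prob_neq_0
  by (simp add: cv2_def mu_var_def mu_op_eq gam_op_f_val[OF assms] field_simps power2_eq_square)

lemma cv2_0: "cv2 0 = 0" and cv2_last: "cv2 (levels S + 1) = 0"
  using hit_prob_neq_0 by (simp_all add: cv2_def mu_var_def mu_op_def mu_def gam_op_def idx_def gam_def f_val_def)

text \<open>Since \<open>\<mu>\<^sub>k(g\<^sub>k) = \<gamma>\<^sub>k\<^sub>+\<^sub>1(1) / \<gamma>\<^sub>k(1)\<close>, these terms are increments of \<open>1 / \<gamma>\<^sub>k(1)\<close>.\<close>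

lemma mu_op_g_val:
  assumes "k \<le> levels S"
  shows "1 / gam1 S k * ((1 - mu_op S k (g_val S k)) / mu_op S k (g_val S k)) = 1 / gam1 S (k + 1) - 1 / gam1 S k"
proof -
  have "mu_op S k (g_val S k) = gam1 S (k + 1) / gam1 S k"
    using gam_op_P_op[OF assms] by (simp add: mu_op_eq g_val_def)
  then show ?thesis
    using gam1_neq_0[of k] gam1_neq_0[of "k + 1"] assms by (simp add: field_simps)
qed

lemma summation_by_parts:
  fixes c b :: "nat \<Rightarrow> real"
  shows "(\<Sum>k\<le>n. c k * (b (Suc k) - b k))
    = (\<Sum>k=1..n. (c (k - 1) - c k) * b k) + c n * b (Suc n) - c 0 * b 0"
  by (induction n) (auto simp: algebra_simps)

text \<open>
  The increments of \<open>\<gamma>\<^sub>k(f\<^sub>k\<^sup>2) / p\<^sup>2 = cv2 k / \<gamma>\<^sub>k(1) + 1 / \<gamma>\<^sub>k(1)\<close> are weighted by \<open>1 / r\<^sub>k\<close>. The increments of \<open>1 / \<gamma>\<^sub>k(1)\<close>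
  are the terms in \<open>g\<^sub>k\<close>; those of \<open>cv2 k / \<gamma>\<^sub>k(1)\<close> are summed by parts, which moves the differences onto
  the weights. No boundary terms remain, because \<open>f\<^sub>0\<close> and \<open>f\<^sub>M\<^sub>+\<^sub>1\<close> are constants and so
  have variance \<open>0\<close>.
\<close>

lemma p_hat_cv:
  assumes N: "1 \<le> N" and R: "\<forall>k\<in>{1..levels S}. 1 \<le> R k"
  shows "p_hat_var S N R / (hit_prob S)\<^sup>2
      = (\<Sum>k=1..levels S. 1 / gam1 S k * (1 / real (rep N R (k - 1)) - 1 / real (rep N R k)) * cv2 k)
      + (\<Sum>k\<le>levels S. 1 / (real (rep N R k) * gam1 S k)
            * ((1 - mu_op S k (g_val S k)) / mu_op S k (g_val S k)))"
proof -
  let ?c = "\<lambda>k. 1 / real (rep N R k)"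
  let ?b = "\<lambda>k. cv2 k / gam1 S k"
  have "p_hat_var S N R / (hit_prob S)\<^sup>2
      = (\<Sum>k\<le>levels S. ?c k * (gam_op S (k + 1) (\<lambda>i. (f_val S (k + 1) i)\<^sup>2) / (hit_prob S)\<^sup>2
          - gam_op S k (\<lambda>i. (f_val S k i)\<^sup>2) / (hit_prob S)\<^sup>2))"
    unfolding p_hat_var_Gam[OF N R] sum_divide_distrib
    by (intro sum.cong refl) (simp only: atMost_iff gam_op_Gam_diag diff_divide_distrib times_divide_eq_right[symmetric])
  also have "\<dots> = (\<Sum>k\<le>levels S. ?c k * (?b (Suc k) - ?b k) + ?c k * (1 / gam1 S (k + 1) - 1 / gam1 S k))"
  proof (intro sum.cong refl)
    fix k assume "k \<in> {..levels S}"
    then have k: "k \<le> levels S + 1" "k + 1 \<le> levels S + 1" by auto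
    show "?c k * (gam_op S (k + 1) (\<lambda>i. (f_val S (k + 1) i)\<^sup>2) / (hit_prob S)\<^sup>2
          - gam_op S k (\<lambda>i. (f_val S k i)\<^sup>2) / (hit_prob S)\<^sup>2)
        = ?c k * (?b (Suc k) - ?b k) + ?c k * (1 / gam1 S (k + 1) - 1 / gam1 S k)"
      unfolding gam_op_f_val_sq[OF k(1)] gam_op_f_val_sq[OF k(2)] distrib_left[symmetric]
      by (simp add: algebra_simps add_divide_distrib diff_divide_distrib)
  qed
  also have "\<dots> = (\<Sum>k\<le>levels S. ?c k * (?b (Suc k) - ?b k))
      + (\<Sum>k\<le>levels S. ?c k * (1 / gam1 S (k + 1) - 1 / gam1 S k))"
    by (rule sum.distrib)
  also have "(\<Sum>k\<le>levels S. ?c k * (?b (Suc k) - ?b k)) = (\<Sum>k=1..levels S. (?c (k - 1) - ?c k) * ?b k)"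
    unfolding summation_by_parts[of ?c ?b] using cv2_0 cv2_last by simp
  also have "\<dots> = (\<Sum>k=1..levels S. 1 / gam1 S k * (?c (k - 1) - ?c k) * cv2 k)"
    by (simp add: mult_ac)
  also have "(\<Sum>k\<le>levels S. ?c k * (1 / gam1 S (k + 1) - 1 / gam1 S k))
      = (\<Sum>k\<le>levels S. 1 / (real (rep N R k) * gam1 S k)
            * ((1 - mu_op S k (g_val S k)) / mu_op S k (g_val S k)))"
  proof (intro sum.cong refl)
    fix k assume "k \<in> {..levels S}"
    then have k: "k \<le> levels S" by simp
    show "?c k * (1 / gam1 S (k + 1) - 1 / gam1 S k) = 1 / (real (rep N R k) * gam1 S k)
            * ((1 - mu_op S k (g_val S k)) / mu_op S k (g_val S k))"
      unfolding mu_op_g_val[OF k, symmetric] by simp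
  qed
  finally show ?thesis .
qed

end

theorem proposition3p1:
  fixes S :: "('w, 'x) splitting_model" and N :: nat and R :: "nat \<Rightarrow> nat"
  assumes "multilevel_splitting S"
    and "1 \<le> N"
    and "\<forall>k\<in>{1..levels S}. 1 \<le> R k"
  shows "p_hat_var S N R / (hit_prob S)\<^sup>2
      = (\<Sum>k=1..levels S. 1 / gam1 S k * (1 / real (rep N R (k - 1)) - 1 / real (rep N R k))
            * (mu_var S k (f_val S k) / (mu_op S k (f_val S k))\<^sup>2))
      + (\<Sum>k=0..levels S. 1 / (real (rep N R k) * gam1 S k)
            * ((1 - mu_op S k (g_val S k)) / mu_op S k (g_val S k)))
    \<and> p_hat_var S N R
      = (\<Sum>i=0..levels S. 1 / real (rep N R i) * gam_op S i (Gam_diag S (i + 1) (f_val S (i + 1))))"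
proof -
  interpret multilevel_splitting S by fact
  show ?thesis
    using p_hat_cv[OF assms(2,3)] p_hat_var_Gam[OF assms(2,3)]
    unfolding cv2_def atMost_atLeast0 by blast
qed

end
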